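(* Let $(T^{\diamond}, T^{\otimes})$ be a $3$-homogeneous latin bitrade. Then $T^{\diamond}$ can be partitioned into three transversals.
   Context: Let $A_1, A_2, A_3$ be finite sets, each of size $n>0$ (the row, column and symbol labels). A partial latin square is a set $T\subseteq A_1\times A_2\times A_3$ in which any two coordinates determine the third: if two elements of $T$ agree in two distinct coordinates, then they are equal. Here $(i,j,k)\in T$ means that symbol $k$ occurs in the cell in row $i$ and column $j$. A (latin) bitrade is a pair $(T^{\diamond},T^{\otimes})$ of partial latin squares $T^{\diamond},T^{\otimes}\subseteq A_1\times A_2\times A_3$ such that: $T^{\diamond}\cap T^{\otimes}=\emptyset$; for all $(a_1,a_2,a_3)\in T^{\diamond}$ and all $r\ne s$ in $\{1,2,3\}$ there is a unique $(b_1,b_2,b_3)\in T^{\otimes}$ with $a_r=b_r$ and $a_s=b_s$; and for all $(a_1,a_2,a_3)\in T^{\otimes}$ and all $r\ne s$ in $\{1,2,3\}$ there is a unique $(b_1,b_2,b_3)\in T^{\diamond}$ with $a_r=b_r$ and $a_s=b_s$. The bitrade is $3$-homogeneous if each row of $T^{\diamond}$ contains exactly $3$ entries, each column of $T^{\diamond}$ contains exactly $3$ entries, and each symbol appears exactly $3$ times in $T^{\diamond}$ (the same then holds for $T^{\otimes}$). A set $\mathfrak{T}\subseteq T^{\diamond}$ is a transversal if $\mathfrak{T}$ meets each row of $T^{\diamond}$ in precisely one entry, each column of $T^{\diamond}$ in precisely one entry, and $|\{k \mid (i,j,k)\in\mathfrak{T}\}| = |\mathfrak{T}|$. *)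

theory Defs
  imports Main "HOL-Library.Disjoint_Sets"
begin

datatype coord = Row | Column | Symbol

fun agree :: "coord \<Rightarrow> 'a \<times> 'b \<times> 'c \<Rightarrow> 'a \<times> 'b \<times> 'c \<Rightarrow> bool" where
  "agree Row (a1, a2, a3) (b1, b2, b3) \<longleftrightarrow> a1 = b1"
| "agree Column (a1, a2, a3) (b1, b2, b3) \<longleftrightarrow> a2 = b2"
| "agree Symbol (a1, a2, a3) (b1, b2, b3) \<longleftrightarrow> a3 = b3"

definition partial_latin_square ::
  "'a set \<Rightarrow> 'b set \<Rightarrow> 'c set \<Rightarrow> ('a \<times> 'b \<times> 'c) set \<Rightarrow> bool" where
  "partial_latin_square A1 A2 A3 T \<longleftrightarrow>
     T \<subseteq> A1 \<times> A2 \<times> A3 \<and>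
     (\<forall>x\<in>T. \<forall>y\<in>T. \<forall>r s. r \<noteq> s \<longrightarrow> agree r x y \<longrightarrow> agree s x y \<longrightarrow> x = y)"

definition bitrade ::
  "'a set \<Rightarrow> 'b set \<Rightarrow> 'c set \<Rightarrow> ('a \<times> 'b \<times> 'c) set \<Rightarrow> ('a \<times> 'b \<times> 'c) set \<Rightarrow> bool" where
  "bitrade A1 A2 A3 T U \<longleftrightarrow>
     partial_latin_square A1 A2 A3 T \<and>
     partial_latin_square A1 A2 A3 U \<and>
     T \<inter> U = {} \<and>
     (\<forall>a\<in>T. \<forall>r s. r \<noteq> s \<longrightarrow> (\<exists>!b. b \<in> U \<and> agree r a b \<and> agree s a b)) \<and>
     (\<forall>a\<in>U. \<forall>r s. r \<noteq> s \<longrightarrow> (\<exists>!b. b \<in> T \<and> agree r a b \<and> agree s a b))"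

definition row_of :: "('a \<times> 'b \<times> 'c) set \<Rightarrow> 'a \<Rightarrow> ('a \<times> 'b \<times> 'c) set" where
  "row_of T i = {(i', j, k) \<in> T. i' = i}"

definition column_of :: "('a \<times> 'b \<times> 'c) set \<Rightarrow> 'b \<Rightarrow> ('a \<times> 'b \<times> 'c) set" where
  "column_of T j = {(i, j', k) \<in> T. j' = j}"

definition symbol_of :: "('a \<times> 'b \<times> 'c) set \<Rightarrow> 'c \<Rightarrow> ('a \<times> 'b \<times> 'c) set" where
  "symbol_of T k = {(i, j, k') \<in> T. k' = k}"

text \<open>Homogeneity is a condition on every label, so no row or column is empty and every symbol
  occurs.\<close>

definition three_homogeneous ::
  "'a set \<Rightarrow> 'b set \<Rightarrow> 'c set \<Rightarrow> ('a \<times> 'b \<times> 'c) set \<Rightarrow> bool" where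
  "three_homogeneous A1 A2 A3 T \<longleftrightarrow>
     (\<forall>i\<in>A1. card (row_of T i) = 3) \<and>
     (\<forall>j\<in>A2. card (column_of T j) = 3) \<and>
     (\<forall>k\<in>A3. card (symbol_of T k) = 3)"

definition transversal ::
  "'a set \<Rightarrow> 'b set \<Rightarrow> ('a \<times> 'b \<times> 'c) set \<Rightarrow> ('a \<times> 'b \<times> 'c) set \<Rightarrow> bool" where
  "transversal A1 A2 T X \<longleftrightarrow>
     X \<subseteq> T \<and>
     (\<forall>i\<in>A1. card (X \<inter> row_of T i) = 1) \<and>
     (\<forall>j\<in>A2. card (X \<inter> column_of T j) = 1) \<and>
     card {k. \<exists>i j. (i, j, k) \<in> X} = card X"

end

theory Submission
  imports Defs
begin

text \<open>For distinct coordinates \<open>r\<close>, \<open>s\<close>, leaving an entry of \<open>T\<close> for the entry of \<open>U\<close> that differs from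
  it only in coordinate \<open>r\<close>, and returning to \<open>T\<close> by a change of coordinate \<open>s\<close> only, is a permutation
  of \<open>T\<close> that fixes the third coordinate and has no fixed point. By 3-homogeneity its cycles are
  exactly the rows (columns, symbols), all of length 3. The three permutations \<open>a\<close>, \<open>b\<close>, \<open>c\<close> obtained
  in this way satisfy \<open>abc = 1\<close>, so they define an action of the triangle group (3,3,3), a group of
  isometries of the Euclidean plane generated by rotations of order 3. A word in \<open>a\<close>, \<open>b\<close>, \<open>c\<close> whose
  length is not divisible by 3 is a rotation, hence conjugate to a power of a generator, and so has no
  fixed point on \<open>T\<close>. Consequently word length modulo 3 defines a colouring of \<open>T\<close> that increases by
  one along each generator, and its colour classes are the transversals.\<close>

section \<open>Potentials modulo the period of a digraph\<close>

lemma relpow_reverse: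
  assumes rev: "\<And>x y. (x, y) \<in> S \<Longrightarrow> (y, x) \<in> S ^^ m" and "(x, y) \<in> S ^^ k"
  shows "(y, x) \<in> S ^^ (m * k)"
  using assms(2)
proof (induction k arbitrary: y)
  case (Suc k)
  then obtain z where "(x, z) \<in> S ^^ k" "(z, y) \<in> S"
    by auto
  with Suc.IH rev show ?case
    by (auto simp: relpow_add)
qed simp

text \<open>\<open>col x\<close> is the length of a chosen walk from a root to \<open>x\<close>.
  Reversibility makes every weak component strong, and two walks with the same ends, closed up by
  one return walk, have congruent lengths modulo \<open>p\<close>.\<close>

lemma potential_mod_exists:
  fixes p :: nat
  assumes rev: "\<And>x y. (x, y) \<in> S \<Longrightarrow> (y, x) \<in> S ^^ (p - 1)"
    and closed_walk: "\<And>x k. (x, x) \<in> S ^^ k \<Longrightarrow> p dvd k"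
    and "p > 0"
  shows "\<exists>col. \<forall>(x, y)\<in>S. col y mod p = Suc (col x) mod p"
proof -
  \<comment> \<open>The choice depends only on the set of vertices that reach \<open>x\<close>; the
    ends of an arc have the same set, hence literally the same root.\<close>
  define root where "root x = (SOME r. (r, x) \<in> S\<^sup>*)" for x
  define col where "col x = (SOME k. (root x, x) \<in> S ^^ k)" for x
  have "(root x, x) \<in> S\<^sup>*" for x
    unfolding root_def by (rule someI[of "\<lambda>r. (r, x) \<in> S\<^sup>*" x]) (rule rtrancl_refl)
  then have col: "(root x, x) \<in> S ^^ col x" for x
    unfolding col_def rtrancl_power by (rule someI_ex)
  have "col y mod p = Suc (col x) mod p" if xy: "(x, y) \<in> S" for x y
  proof -
    have "(y, x) \<in> S\<^sup>*"
      using rev[OF xy] by (auto simp: rtrancl_power)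
    with xy have "(r, x) \<in> S\<^sup>* \<longleftrightarrow> (r, y) \<in> S\<^sup>*" for r
      by (blast intro: rtrancl_into_rtrancl rtrancl_trans)
    then have root: "root x = root y"
      by (simp add: root_def)
    have "(root y, y) \<in> S ^^ Suc (col x)"
      unfolding root[symmetric] using col xy by (rule relpow_Suc_I)
    \<comment> \<open>The return walk counts as minus \<open>col y\<close> modulo \<open>p\<close>,
      so closing up compares \<open>Suc (col x)\<close> with \<open>col y\<close>.\<close>
    moreover have "(y, root y) \<in> S ^^ ((p - 1) * col y)"
      using rev col by (rule relpow_reverse)
    ultimately have "(root y, root y) \<in> S ^^ (Suc (col x) + (p - 1) * col y)"
      unfolding relpow_add by (rule relcompI)
    then have "p dvd Suc (col x) + (p - 1) * col y"
      by (rule closed_walk)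
    then have "(Suc (col x) + (p - 1) * col y + col y) mod p = col y mod p"
      by (elim dvdE) (simp only: mod_mult_self4)
    moreover have "Suc (col x) + (p - 1) * col y + col y = Suc (col x) + p * col y"
      using \<open>p > 0\<close> by (cases p) auto
    ultimately show ?thesis
      by (simp only: mod_mult_self2)
  qed
  then show ?thesis
    by auto
qed

section \<open>Actions of the triangle group (3,3,3)\<close>

lemma funpow_intertwine:
  assumes "\<And>x. f (g x) = h (f x)"
  shows "f ((g ^^ n) x) = (h ^^ n) (f x)"
  using assms by (induction n) auto

locale triangle_action_333 =
  fixes a b c :: "'x \<Rightarrow> 'x"
  assumes a3 [simp]: "a (a (a x)) = x"
    and b3 [simp]: "b (b (b x)) = x"
    and c3 [simp]: "c (c (c x)) = x"
    and abc [simp]: "a (b (c x)) = x"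
begin

text \<open>The translations by the three vectors of a regular triangle, permuted cyclically under
  conjugation by \<open>a\<close>.\<close>

definition "s x = a (b (b x))"
definition "t x = a (a (b (b (a (a x)))))"
definition "u x = b (b (a x))"

lemma c_eq: "c x = b (b (a (a x)))"
  by (metis a3 abc b3)

text \<open>The relation \<open>c3\<close> written in \<open>a\<close> and \<open>b\<close>, with
  squares standing for inverses. It makes \<open>s\<close> and \<open>u\<close> commute; conjugation
  by \<open>a\<close> carries this to the other pairs.\<close>

lemma aba: "b (b (a (a (b (b x))))) = a (b (a x))"
  using c3[of "a (b (a x))"] unfolding c_eq by simp

lemma a_s: "a (s x) = t (a x)" and a_t: "a (t x) = u (a x)" and a_u: "a (u x) = s (a x)"
  by (simp_all add: s_def t_def u_def)

lemma s_u: "s (u x) = u (s x)"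
  by (simp add: s_def u_def aba)

lemma s_t: "s (t x) = t (s x)"
  using arg_cong[OF s_u, of a "a (a x)"] by (simp add: a_s a_u)

lemma t_u: "t (u x) = u (t x)"
  using arg_cong[OF s_t, of a "a (a x)"] by (simp add: a_s a_t)

lemma stu: "s (t (u x)) = x"
proof -
  have "u (s (t x)) = x"
    by (simp add: s_u[symmetric]) (simp add: s_def t_def u_def aba[symmetric])
  then show ?thesis
    by (simp add: s_u t_u)
qed

text \<open>Natural exponents suffice: by \<open>stu\<close>, the inverse of one translation is the
  product of the other two. Raising all three exponents by one leaves the map unchanged.\<close>

definition translate :: "nat \<Rightarrow> nat \<Rightarrow> nat \<Rightarrow> 'x \<Rightarrow> 'x" where
  "translate i j l x = (s ^^ i) ((t ^^ j) ((u ^^ l) x))"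

lemma translate_0 [simp]: "translate 0 0 0 x = x"
  by (simp add: translate_def)

lemma translate_Suc:
  "translate (Suc i) j l x = s (translate i j l x)"
  "translate i (Suc j) l x = t (translate i j l x)"
  "translate i j (Suc l) x = u (translate i j l x)"
  by (simp_all add: translate_def funpow_intertwine[where f = t and g = s, OF s_t[symmetric]]
      funpow_intertwine[where f = u and g = s, OF s_u[symmetric]]
      funpow_intertwine[where f = u and g = t, OF t_u[symmetric]])

lemma translate_shift:
  "translate i j l (s x) = s (translate i j l x)"
  "translate i j l (t x) = t (translate i j l x)"
  "translate i j l (u x) = u (translate i j l x)"
  by (induction i, induction j, induction l, simp_all add: translate_Suc s_t s_u t_u)+

lemma a_translate: "a (translate i j l x) = translate l i j (a x)"
  by (induction i, induction j, induction l) (simp_all add: translate_Suc a_s a_t a_u)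

text \<open>By definition of \<open>s\<close>, \<open>b\<close> is \<open>a\<close> followed by the
  inverse of \<open>s\<close>, and that inverse is \<open>t\<close> times \<open>u\<close> by
  \<open>stu\<close>.\<close>

lemma b_eq: "b x = t (u (a x))"
proof -
  have "s (b x) = a x"
    by (simp add: s_def)
  moreover have "t (u (s (b x))) = b x"
    using stu[of "b x"] by (simp add: s_t s_u)
  ultimately show ?thesis
    by simp
qed

section \<open>Walks along the generators and their normal form\<close>

definition step :: "'x set \<Rightarrow> ('x \<times> 'x) set" where
  "step T = {(x, y). x \<in> T \<and> (y = a x \<or> y = b x \<or> y = c x)}"

text \<open>Each generator is \<open>a\<close> followed by a translation, and \<open>a\<close> moves
  past translations by permuting the exponents cyclically. So the translations collect on the left
  and the length alone determines the power of \<open>a\<close>.\<close>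

lemma walk_normal_form:
  "(x, y) \<in> step T ^^ k \<Longrightarrow> \<exists>i j l. y = translate i j l ((a ^^ k) x)"
proof (induction k arbitrary: y)
  case 0
  then show ?case
    using translate_0 by (metis funpow_0 pair_in_Id_conv relpow.simps(1))
next
  case (Suc k)
  then obtain z where z: "(z, y) \<in> step T" and "(x, z) \<in> step T ^^ k"
    by auto
  then obtain i j l where "z = translate i j l ((a ^^ k) x)"
    using Suc.IH by blast
  then have az: "a z = translate l i j ((a ^^ Suc k) x)"
    by (simp add: a_translate)
  have "b z = translate l (Suc i) (Suc j) ((a ^^ Suc k) x)"
    by (simp add: b_eq az translate_Suc t_u)
  moreover have "c z = t (u (u (s (a z))))"
    by (simp add: c_eq b_eq a_s a_t a_u)
  then have "c z = translate (Suc l) (Suc i) (Suc (Suc j)) ((a ^^ Suc k) x)"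
    by (simp add: az translate_Suc s_t s_u t_u)
  ultimately show ?case
    using z az unfolding step_def by blast
qed

end

section \<open>Rotations without fixed points\<close>

locale free_triangle_action_333 = triangle_action_333 a b c for a b c :: "'x \<Rightarrow> 'x" +
  fixes T :: "'x set"
  assumes a_closed: "x \<in> T \<Longrightarrow> a x \<in> T"
    and b_closed: "x \<in> T \<Longrightarrow> b x \<in> T"
    and a_free: "x \<in> T \<Longrightarrow> a x \<noteq> x"
    and b_free: "x \<in> T \<Longrightarrow> b x \<noteq> x"
    and c_free: "x \<in> T \<Longrightarrow> c x \<noteq> x"
begin

definition rotation_fix :: "nat \<Rightarrow> nat \<Rightarrow> nat \<Rightarrow> bool" where
  "rotation_fix i j l \<longleftrightarrow> (\<exists>x\<in>T. translate i j l (a x) = x)"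

lemma translate_closed: "x \<in> T \<Longrightarrow> translate i j l x \<in> T"
proof -
  have "s x \<in> T" "t x \<in> T" "u x \<in> T" if "x \<in> T" for x
    using that by (simp_all add: s_def t_def u_def a_closed b_closed)
  then have "(s ^^ n) x \<in> T" "(t ^^ n) x \<in> T" "(u ^^ n) x \<in> T" if "x \<in> T" for x n
    using that by (induction n) auto
  then show "x \<in> T \<Longrightarrow> translate i j l x \<in> T"
    by (simp add: translate_def)
qed

text \<open>If \<open>w a\<close> fixes \<open>x\<close> for a translation \<open>w = f v\<close>, then \<open>g v a\<close>, its conjugate by \<open>f\<close>, fixes \<open>v (a x)\<close>.\<close>

lemma rotation_fix_conjugate:
  assumes "\<exists>x\<in>T. f (translate i j l (a x)) = x"
    and "\<And>y. a (f y) = g (a y)" and "\<And>y. translate i j l (g y) = g (translate i j l y)"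
  shows "\<exists>x\<in>T. g (translate i j l (a x)) = x"
proof -
  obtain x where "x \<in> T" and x: "f (translate i j l (a x)) = x"
    using assms(1) by blast
  have "g (translate i j l (a (translate i j l (a x)))) = translate i j l (a x)"
    by (simp add: x flip: assms(2,3))
  moreover have "translate i j l (a x) \<in> T"
    using \<open>x \<in> T\<close> by (simp add: translate_closed a_closed)
  ultimately show ?thesis
    by blast
qed

text \<open>Conjugation by a translation moves one unit of exponent along the cycle
  \<open>s\<close>, \<open>t\<close>, \<open>u\<close>. Hence only the sum of the exponents matters,
  and all of it can be gathered on \<open>s\<close>.\<close>

lemma rotation_fix_shift:
  "rotation_fix (Suc i) j l \<Longrightarrow> rotation_fix i (Suc j) l"
  "rotation_fix i (Suc j) l \<Longrightarrow> rotation_fix i j (Suc l)"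
  "rotation_fix i j (Suc l) \<Longrightarrow> rotation_fix (Suc i) j l"
  unfolding rotation_fix_def translate_Suc
  using rotation_fix_conjugate[of s i j l t, OF _ a_s translate_shift(2)]
    rotation_fix_conjugate[of t i j l u, OF _ a_t translate_shift(3)]
    rotation_fix_conjugate[of u i j l s, OF _ a_u translate_shift(1)] by auto

lemma rotation_fix_collect: "rotation_fix i j l \<Longrightarrow> rotation_fix (i + j + l) 0 0"
proof (induction l arbitrary: i)
  case 0
  then show ?case
  proof (induction j arbitrary: i)
    case (Suc j)
    then show ?case
      using rotation_fix_shift(2,3)[of i j] by fastforce
  qed simp
next
  case (Suc l)
  then show ?case
    using rotation_fix_shift(3)[of i j l] by fastforce
qed

text \<open>Since \<open>s\<close>, \<open>t\<close>, \<open>u\<close> multiply to the identity, there are only three conjugacy classes of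
  rotations by the angle of \<open>a\<close>, represented by the generators \<open>a\<close>, \<open>b\<close> and \<open>c\<close>.\<close>

lemma no_rotation_fix_power: "\<not> rotation_fix m 0 0"
proof (induction m rule: less_induct)
  case (less m)
  consider "m = 0" | "m = 1" | "m = 2" | k where "m = Suc (Suc (Suc k))"
    by (metis One_nat_def Suc_1 not0_implies_Suc)
  then show ?case
  proof cases
    case 1
    then show ?thesis
      using a_free by (auto simp: rotation_fix_def)
  next
    case 2
    \<comment> \<open>Here \<open>s\<close> after \<open>a\<close> is conjugate to \<open>c\<close>:
      a fixed point \<open>x\<close> makes \<open>a (a x)\<close> a fixed point of
      \<open>c\<close>.\<close>
    have False if "x \<in> T" "s (a x) = x" for x
    proof -
      have "b (b (a x)) = a (a x)"
        using arg_cong[OF that(2), of "\<lambda>x. a (a x)"] by (simp add: s_def)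
      then have "c (a (a x)) = a (a x)"
        by (simp add: c_eq)
      then show False
        using c_free that(1) a_closed by blast
    qed
    with 2 show ?thesis
      by (auto simp: rotation_fix_def translate_Suc)
  next
    case 3
    \<comment> \<open>The product of \<open>s\<close> and \<open>t\<close> is the inverse of
      \<open>u\<close>, so \<open>u x = a x\<close>, and \<open>b\<close> fixes \<open>a x\<close>.
      The exponents 1, 1, 0 represent the class of 2, 0, 0.\<close>
    have False if "x \<in> T" "s (t (a x)) = x" for x
    proof -
      have "u x = a x"
        using arg_cong[OF that(2), of u] stu[of "a x"] by (simp add: s_u t_u)
      then have "b (a x) = a x"
        by (metis b3 u_def)
      then show False
        using b_free that(1) a_closed by blast
    qed
    then have "\<not> rotation_fix 1 1 0"
      by (auto simp: rotation_fix_def translate_Suc s_t)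
    then show ?thesis
      using 3 rotation_fix_shift(1)[of 1 0 0] by (auto simp: numeral_2_eq_2)
  next
    case 4
    \<comment> \<open>The exponent \<open>k + 3\<close> on \<open>s\<close> is spread out as
      \<open>k + 1\<close>, 1, 1; cancelling one factor of each kind leaves the smaller exponent
      \<open>k\<close>.\<close>
    have "u (t (s y)) = y" for y
      using stu[of y] by (simp add: s_t s_u t_u)
    then have "\<not> rotation_fix (Suc k) 1 1"
      using less[of k] 4 by (simp add: rotation_fix_def translate_Suc)
    then show ?thesis
      using 4 rotation_fix_shift(1)[of "Suc (Suc k)" 0 0]
        rotation_fix_shift(1)[of "Suc k" 1 0] rotation_fix_shift(2)[of "Suc k" 1 0] by auto
  qed
qed

section \<open>Closed walks and the colouring\<close>

lemma step_closed: "(x, y) \<in> step T \<Longrightarrow> y \<in> T"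
  by (auto simp: step_def a_closed b_closed c_eq)

lemma step_reverse:
  assumes "(x, y) \<in> step T"
  shows "(y, x) \<in> step T ^^ 2"
proof -
  obtain f where f: "f \<in> {a, b, c}" "y = f x"
    using assms unfolding step_def by blast
  have "(z, f z) \<in> step T" if "z \<in> T" for z
    using that f(1) unfolding step_def by blast
  moreover have "y \<in> T"
    using assms by (rule step_closed)
  ultimately have "(y, f y) \<in> step T" "(f y, f (f y)) \<in> step T"
    using step_closed by blast+
  then have "(y, f (f y)) \<in> step T ^^ Suc (Suc 0)"
    by (intro relpow_Suc_I[where n = "Suc 0"]) simp_all
  moreover have "f (f y) = x"
    using f a3 b3 c3 by blast
  ultimately show ?thesis
    unfolding numeral_2_eq_2 by simp
qed

text \<open>A closed walk of length 1 modulo 3 would give a rotation with a fixed point in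
  \<open>T\<close>. Length 2 modulo 3 reduces to this by traversing the walk twice.\<close>

lemma closed_walk_dvd:
  assumes "(x, x) \<in> step T ^^ k"
  shows "3 dvd k"
proof -
  have no1: "k mod 3 \<noteq> 1" if walk: "(x, x) \<in> step T ^^ k" for k
  proof
    assume k: "k mod 3 = 1"
    then obtain k' where "k = Suc k'"
      by (cases k) auto
    then have "x \<in> T"
      using walk step_closed by (blast elim: relpow_Suc_E)
    have "(a ^^ 3) x = x"
      by (simp add: numeral_3_eq_3)
    then have "(a ^^ k) x = a x"
      using k by (simp flip: funpow_mod_eq[of 3 a x k])
    then obtain i j l where "translate i j l (a x) = x"
      using walk_normal_form[OF walk] by metis
    with \<open>x \<in> T\<close> show False
      using rotation_fix_collect no_rotation_fix_power unfolding rotation_fix_def by blast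
  qed
  have "(x, x) \<in> step T ^^ (k + k)"
    using assms unfolding relpow_add by blast
  then have "k mod 3 \<noteq> 1" "(k + k) mod 3 \<noteq> 1"
    using no1 assms by blast+
  then show ?thesis
    by presburger
qed

lemma colouring_exists:
  "\<exists>col :: 'x \<Rightarrow> nat. \<forall>x\<in>T. \<forall>f\<in>{a, b, c}. col (f x) mod 3 = Suc (col x) mod 3"
proof -
  have "\<exists>col. \<forall>(x, y)\<in>step T. col y mod 3 = Suc (col x) mod (3::nat)"
    using step_reverse closed_walk_dvd by (intro potential_mod_exists) simp_all
  then obtain col :: "'x \<Rightarrow> nat"
    where col: "\<And>x y. (x, y) \<in> step T \<Longrightarrow> col y mod 3 = Suc (col x) mod 3"
    by blast
  have "(x, f x) \<in> step T" if "x \<in> T" "f \<in> {a, b, c}" for x f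
    using that by (auto simp: step_def)
  with col show ?thesis
    by blast
qed

end

section \<open>The permutations of a bitrade\<close>

lemma agree_refl: "agree r x x"
  by (cases r; cases x) auto

lemma agree_sym: "agree r x y \<Longrightarrow> agree r y x"
  by (cases r; cases x; cases y) auto

lemma agree_trans: "agree r x y \<Longrightarrow> agree r y z \<Longrightarrow> agree r x z"
  by (cases r; cases x; cases y; cases z) auto

lemma agree_all_eq: "(\<And>r. agree r x y) \<Longrightarrow> x = y"
  using agree.simps by (metis prod_cases3)

lemma bitrade_sym: "bitrade A1 A2 A3 T U \<Longrightarrow> bitrade A1 A2 A3 U T"
  unfolding bitrade_def by (simp add: Int_commute)

definition partner :: "('a \<times> 'b \<times> 'c) set \<Rightarrow> coord \<Rightarrow> 'a \<times> 'b \<times> 'c \<Rightarrow> 'a \<times> 'b \<times> 'c" where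
  "partner U r x = (THE u. u \<in> U \<and> (\<forall>t. t \<noteq> r \<longrightarrow> agree t x u))"

lemma partner_ex1:
  assumes "bitrade A1 A2 A3 T U" "x \<in> T"
  shows "\<exists>!u. u \<in> U \<and> (\<forall>t. t \<noteq> r \<longrightarrow> agree t x u)"
proof -
  obtain r1 r2 where r: "r1 \<noteq> r2" "\<And>t. t \<noteq> r \<longleftrightarrow> t = r1 \<or> t = r2"
    by (cases r) (metis coord.exhaust coord.distinct)+
  have "\<exists>!u. u \<in> U \<and> agree r1 x u \<and> agree r2 x u"
    using assms r(1) unfolding bitrade_def by blast
  then show ?thesis
    unfolding r(2) by (metis (no_types, lifting))
qed

lemma partner:
  assumes "bitrade A1 A2 A3 T U" "x \<in> T"
  shows "partner U r x \<in> U" and "t \<noteq> r \<Longrightarrow> agree t x (partner U r x)"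
  using theI'[OF partner_ex1[OF assms, of r]] by (auto simp: partner_def)

lemma partner_partner:
  assumes "bitrade A1 A2 A3 T U" "x \<in> T"
  shows "partner T r (partner U r x) = x"
proof -
  note U = partner[OF assms]
  note T = partner[OF bitrade_sym[OF assms(1)] U(1)[of r]]
  show ?thesis
    using partner_ex1[OF bitrade_sym[OF assms(1)] U(1)[of r], of r] T assms(2) U(2)
    by (metis agree_sym)
qed

text \<open>Identity outside \<open>T\<close>, so that the relations of the triangle group hold everywhere.\<close>

definition tau :: "('a \<times> 'b \<times> 'c) set \<Rightarrow> ('a \<times> 'b \<times> 'c) set \<Rightarrow> coord \<Rightarrow> coord
    \<Rightarrow> 'a \<times> 'b \<times> 'c \<Rightarrow> 'a \<times> 'b \<times> 'c" where
  "tau T U r s x = (if x \<in> T then partner T s (partner U r x) else x)"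

context
  fixes A1 A2 A3 T U
  assumes bitrade: "bitrade A1 A2 A3 T U"
begin

lemmas to_U = partner[OF bitrade]
lemmas to_T = partner[OF bitrade_sym[OF bitrade]]

lemma tau_closed: "x \<in> T \<Longrightarrow> tau T U r s x \<in> T"
  by (simp add: tau_def to_T to_U)

lemma tau_agree: "x \<in> T \<Longrightarrow> t \<noteq> r \<Longrightarrow> t \<noteq> s \<Longrightarrow> agree t x (tau T U r s x)"
  unfolding tau_def using to_T(2) to_U agree_trans by (metis (full_types))

text \<open>Returning to \<open>T\<close> along \<open>s\<close> and leaving again along
  \<open>s\<close> cancel. This telescoping is the source of \<open>abc = 1\<close>.\<close>

lemma tau_tau: "tau T U s t (tau T U r s x) = tau T U r t x"
  by (simp add: tau_def to_T to_U partner_partner[OF bitrade_sym[OF bitrade]])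

lemma tau_same: "tau T U r r x = x"
  by (simp add: tau_def partner_partner[OF bitrade])

lemma tau_inj: "tau T U r s x = tau T U r s y \<Longrightarrow> x = y"
  by (metis tau_same tau_tau)

text \<open>A fixed point would have the same partner along \<open>r\<close> and along
  \<open>s\<close>. That partner agrees with it in every coordinate, contradicting the disjointness
  of \<open>T\<close> and \<open>U\<close>.\<close>

lemma tau_free:
  assumes "x \<in> T" "r \<noteq> s"
  shows "tau T U r s x \<noteq> x"
proof
  assume "tau T U r s x = x"
  then have "partner T s (partner U r x) = x"
    using assms(1) by (simp add: tau_def)
  then have "partner U r x = partner U s x"
    using partner_partner[OF bitrade_sym[OF bitrade] to_U(1)[OF assms(1)]] by metis
  then have "agree t x (partner U r x)" for t
    using to_U(2)[OF assms(1)] assms(2) by metis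
  then have "x = partner U r x"
    by (rule agree_all_eq)
  then show False
    using to_U(1)[OF assms(1), of r] assms(1) bitrade unfolding bitrade_def by auto
qed

end

text \<open>A 2-cycle is impossible: a point \<open>z\<close> outside it has its image outside it
  too and distinct from \<open>z\<close>, which makes four points.\<close>

lemma free_permutation_card_3:
  assumes L: "card L = 3" "x \<in> L"
    and closed: "\<And>y. y \<in> L \<Longrightarrow> f y \<in> L" and free: "\<And>y. y \<in> L \<Longrightarrow> f y \<noteq> y"
    and inj: "\<And>y z. f y = f z \<Longrightarrow> y = z"
  shows "L = {x, f x, f (f x)}" and "f (f (f x)) = x"
proof -
  have fin: "finite L"
    using L(1) by (metis card.infinite zero_neq_numeral)
  have no2: "f (f x) \<noteq> x"
  proof
    assume 2: "f (f x) = x"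
    have "card {x, f x} \<le> 2"
      by (simp add: card_insert_if)
    then have "\<not> L \<subseteq> {x, f x}"
      using card_mono[of "{x, f x}" L] L(1) by (intro notI) simp
    then obtain z where z: "z \<in> L" "z \<noteq> x" "z \<noteq> f x"
      by blast
    have "f z \<noteq> x"
      using inj[of z "f x"] 2 z(3) by auto
    moreover have "f z \<noteq> f x"
      using inj z(2) by blast
    ultimately have "card {x, f x, z, f z} = 4"
      using z free[OF L(2), symmetric] free[OF z(1), symmetric] by (simp add: eq_commute[of _ "f z"])
    moreover have "{x, f x, z, f z} \<subseteq> L"
      using z(1) L(2) closed by blast
    ultimately show False
      using card_mono[OF fin, of "{x, f x, z, f z}"] L(1) by linarith
  qed
  have fx: "f x \<in> L" "f (f x) \<in> L"
    using L(2) closed by simp_all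
  have "card {x, f x, f (f x)} = 3"
    using no2[symmetric] free[OF L(2)] free[OF fx(1)] by simp
  moreover have "{x, f x, f (f x)} \<subseteq> L"
    using L(2) fx by simp
  ultimately show L_eq: "L = {x, f x, f (f x)}"
    using card_subset_eq[OF fin] L(1) by metis
  have "f (f (f x)) \<in> L"
    using closed fx(2) by blast
  moreover have "f (f (f x)) \<noteq> f (f x)"
    using free fx(2) by blast
  moreover have "f (f (f x)) \<noteq> f x"
    using inj no2 by blast
  ultimately show "f (f (f x)) = x"
    unfolding L_eq by blast
qed

section \<open>Colour classes are transversals\<close>

lemma card_line:
  assumes "partial_latin_square A1 A2 A3 T" "three_homogeneous A1 A2 A3 T" "x \<in> T"
  shows "card {y \<in> T. agree r x y} = 3"
proof -
  obtain i j k where x: "x = (i, j, k)"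
    by (cases x)
  then have "i \<in> A1" "j \<in> A2" "k \<in> A3"
    using assms unfolding partial_latin_square_def by auto
  moreover have "{y \<in> T. agree Row x y} = row_of T i"
    "{y \<in> T. agree Column x y} = column_of T j" "{y \<in> T. agree Symbol x y} = symbol_of T k"
    unfolding x row_of_def column_of_def symbol_of_def by auto
  ultimately show ?thesis
    using assms(2) unfolding three_homogeneous_def by (cases r) auto
qed

lemma card_Collect_ex1: "\<exists>!y. P y \<Longrightarrow> card {y. P y} = 1"
proof (erule ex1E)
  fix y
  assume "P y" "\<forall>z. P z \<longrightarrow> z = y"
  then have "{y. P y} = {y}"
    by blast
  then show ?thesis
    by simp
qed

lemma mod_3_successive:
  fixes i j k m :: nat
  assumes "j mod 3 = Suc i mod 3" "k mod 3 = Suc j mod 3" "m < 3"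
  shows "i mod 3 = m \<and> j mod 3 \<noteq> m \<and> k mod 3 \<noteq> m \<or>
    i mod 3 \<noteq> m \<and> j mod 3 = m \<and> k mod 3 \<noteq> m \<or>
    i mod 3 \<noteq> m \<and> j mod 3 \<noteq> m \<and> k mod 3 = m"
  using assms mod_less_divisor[of 3 i] unfolding mod_Suc by (auto split: if_splits)

text \<open>Every line is a 3-cycle of one generator, and the colour rises by one along it, so all
  three residues occur once.\<close>

lemma rainbow_colouring:
  assumes bt: "bitrade A1 A2 A3 T U" and hom: "three_homogeneous A1 A2 A3 T"
  shows "\<exists>col :: 'a \<times> 'b \<times> 'c \<Rightarrow> nat. \<forall>x\<in>T. \<forall>r. \<forall>m<3.
    \<exists>!y. y \<in> T \<and> agree r x y \<and> col y mod 3 = m"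
proof -
  have "partial_latin_square A1 A2 A3 T"
    using bt unfolding bitrade_def by (rule conjunct1)
  note line = card_line[OF this hom]
  have cycle: "{y \<in> T. agree r x y} = {x, tau T U p q x, tau T U p q (tau T U p q x)}"
      "tau T U p q (tau T U p q (tau T U p q x)) = x"
    if "x \<in> T" "r \<noteq> p" "r \<noteq> q" "p \<noteq> q" for x r p q
  proof -
    have x: "x \<in> {y \<in> T. agree r x y}"
      using that(1) agree_refl by blast
    have closed: "tau T U p q y \<in> {y \<in> T. agree r x y}" if "y \<in> {y \<in> T. agree r x y}" for y
      using that tau_closed[OF bt] agree_trans[OF _ tau_agree[OF bt _ \<open>r \<noteq> p\<close> \<open>r \<noteq> q\<close>]] by simp
    have free: "tau T U p q y \<noteq> y" if "y \<in> {y \<in> T. agree r x y}" for y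
      using that tau_free[OF bt _ \<open>p \<noteq> q\<close>] by blast
    note * = free_permutation_card_3[OF line[OF that(1)] x closed free tau_inj[OF bt]]
    show "{y \<in> T. agree r x y} = {x, tau T U p q x, tau T U p q (tau T U p q x)}"
      by (rule *(1))
    show "tau T U p q (tau T U p q (tau T U p q x)) = x"
      by (rule *(2))
  qed
  \<comment> \<open>The second coordinate of \<open>c\<close> is the first of \<open>b\<close>, that
    of \<open>b\<close> the first of \<open>a\<close>, and that of \<open>a\<close> the first of
    \<open>c\<close>, so \<open>a (b (c x))\<close> telescopes to \<open>x\<close>.\<close>
  define a where "a = tau T U Column Symbol"
  define b where "b = tau T U Row Column"
  define c where "c = tau T U Symbol Row"
  have out: "tau T U p q x = x" if "x \<notin> T" for x p q
    using that by (simp add: tau_def)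
  interpret free_triangle_action_333 a b c T
  proof
    show "a (a (a x)) = x" for x
      unfolding a_def using cycle(2)[of x Row Column Symbol] out by (cases "x \<in> T") simp_all
    show "b (b (b x)) = x" for x
      unfolding b_def using cycle(2)[of x Symbol Row Column] out by (cases "x \<in> T") simp_all
    show "c (c (c x)) = x" for x
      unfolding c_def using cycle(2)[of x Column Symbol Row] out by (cases "x \<in> T") simp_all
  qed (simp_all add: a_def b_def c_def tau_tau[OF bt] tau_same[OF bt] tau_closed[OF bt] tau_free[OF bt])
  obtain col :: "'a \<times> 'b \<times> 'c \<Rightarrow> nat"
    where col: "\<forall>x\<in>T. \<forall>f\<in>{a, b, c}. col (f x) mod 3 = Suc (col x) mod 3"
    using colouring_exists by (rule exE)
  have "\<exists>!y. y \<in> T \<and> agree r x y \<and> col y mod 3 = m" if "x \<in> T" "m < 3" for x r m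
  proof -
    \<comment> \<open>Rows are cycles of \<open>a\<close>, columns of \<open>c\<close>, symbols of
      \<open>b\<close>.\<close>
    have "\<exists>f\<in>{a, b, c}. {y \<in> T. agree r x y} = {x, f x, f (f x)}"
      using cycle(1)[OF \<open>x \<in> T\<close>, of Row Column Symbol]
        cycle(1)[OF \<open>x \<in> T\<close>, of Column Symbol Row]
        cycle(1)[OF \<open>x \<in> T\<close>, of Symbol Row Column]
      unfolding a_def b_def c_def by (cases r) simp_all
    then obtain f where f: "f \<in> {a, b, c}" "{y \<in> T. agree r x y} = {x, f x, f (f x)}"
      by blast
    then have "f x \<in> T"
      by blast
    then have col_f: "col (f x) mod 3 = Suc (col x) mod 3"
        "col (f (f x)) mod 3 = Suc (col (f x)) mod 3"
      using bspec[OF bspec[OF col] f(1)] \<open>f x \<in> T\<close> \<open>x \<in> T\<close> by simp_all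
    have line_iff: "y \<in> T \<and> agree r x y \<longleftrightarrow> y = x \<or> y = f x \<or> y = f (f x)" for y
      using arg_cong[OF f(2), of "\<lambda>L. y \<in> L"] by simp
    consider "col x mod 3 = m" "col (f x) mod 3 \<noteq> m" "col (f (f x)) mod 3 \<noteq> m"
      | "col x mod 3 \<noteq> m" "col (f x) mod 3 = m" "col (f (f x)) mod 3 \<noteq> m"
      | "col x mod 3 \<noteq> m" "col (f x) mod 3 \<noteq> m" "col (f (f x)) mod 3 = m"
      using mod_3_successive[OF col_f \<open>m < 3\<close>] by blast
    then have "\<exists>!y. (y = x \<or> y = f x \<or> y = f (f x)) \<and> col y mod 3 = m"
      by cases blast+
    then show ?thesis
      by (simp flip: line_iff add: conj_assoc)
  qed
  then show ?thesis
    by blast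
qed

theorem theorem1p1:
  fixes A1 :: "'a set" and A2 :: "'b set" and A3 :: "'c set" and n :: nat
    and T U :: "('a \<times> 'b \<times> 'c) set"
  assumes "n > 0"
    and "finite A1" and "finite A2" and "finite A3"
    and "card A1 = n" and "card A2 = n" and "card A3 = n"
    and "bitrade A1 A2 A3 T U"
    and "three_homogeneous A1 A2 A3 T"
  shows "\<exists>P. partition_on T P \<and> card P = 3 \<and> (\<forall>X\<in>P. transversal A1 A2 T X)"
proof -
  obtain col :: "'a \<times> 'b \<times> 'c \<Rightarrow> nat" where
    "\<forall>x\<in>T. \<forall>r. \<forall>m<3. \<exists>!y. y \<in> T \<and> agree r x y \<and> col y mod 3 = m"
    using rainbow_colouring[OF assms(8,9)] by (rule exE)
  then have col: "\<exists>!y. y \<in> T \<and> agree r x y \<and> col y mod 3 = m" if "x \<in> T" "m < 3" for x r m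
    using that by simp
  define K where "K m = {x \<in> T. col x mod 3 = m}" for m
  have row_ne: "\<exists>x\<in>T. fst x = i" if "i \<in> A1" for i
  proof -
    have "row_of T i \<noteq> {}"
      using assms(9) that unfolding three_homogeneous_def by (metis card.empty zero_neq_numeral)
    then show ?thesis
      unfolding row_of_def by force
  qed
  have column_ne: "\<exists>x\<in>T. fst (snd x) = j" if "j \<in> A2" for j
  proof -
    have "column_of T j \<noteq> {}"
      using assms(9) that unfolding three_homogeneous_def by (metis card.empty zero_neq_numeral)
    then show ?thesis
      unfolding column_of_def by force
  qed
  \<comment> \<open>\<open>n > 0\<close> supplies an entry of \<open>T\<close>. Its row contains
    every colour, so the three classes are non-empty and therefore distinct.\<close>
  obtain i0 where "i0 \<in> A1"
    using assms(1,5) by (metis card.empty ex_in_conv less_numeral_extra(3))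
  then obtain x0 where "x0 \<in> T"
    using row_ne by blast
  then have K_ne: "K m \<noteq> {}" if "m < 3" for m
    using ex1_implies_ex[OF col[OF _ that, of x0 Row]] unfolding K_def by blast
  have K_inj: "inj_on K {..<3}"
    using K_ne unfolding K_def inj_on_def by blast
  have "partition_on T (K ` {..<3})"
  proof (rule partition_onI)
    show "\<Union> (K ` {..<3}) = T"
      unfolding K_def by auto
  qed (use K_ne in \<open>auto simp: K_def disjnt_def\<close>)
  moreover have "card (K ` {..<3}) = 3"
    using K_inj by (simp add: card_image)
  moreover have "transversal A1 A2 T (K m)" if m: "m < 3" for m
    unfolding transversal_def
  proof (intro conjI ballI)
    show "K m \<subseteq> T"
      unfolding K_def by blast
    show "card (K m \<inter> row_of T i) = 1" if i: "i \<in> A1" for i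
    proof -
      obtain x where x: "x \<in> T" "fst x = i"
        using row_ne i by blast
      then have "K m \<inter> row_of T i = {y. y \<in> T \<and> agree Row x y \<and> col y mod 3 = m}"
        unfolding K_def row_of_def by (cases x) auto
      then show ?thesis
        using card_Collect_ex1[OF col[OF x(1) m, of Row]] by simp
    qed
    show "card (K m \<inter> column_of T j) = 1" if j: "j \<in> A2" for j
    proof -
      obtain x where x: "x \<in> T" "fst (snd x) = j"
        using column_ne j by blast
      then have "K m \<inter> column_of T j = {y. y \<in> T \<and> agree Column x y \<and> col y mod 3 = m}"
        unfolding K_def column_of_def by (cases x) auto
      then show ?thesis
        using card_Collect_ex1[OF col[OF x(1) m, of Column]] by simp
    qed
    \<comment> \<open>Two entries of one class with a common symbol lie on one line, where each
      colour occurs only once.\<close>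
    have "inj_on (\<lambda>x. snd (snd x)) (K m)"
    proof (rule inj_onI)
      fix x y
      assume x: "x \<in> K m" and y: "y \<in> K m" and "snd (snd x) = snd (snd y)"
      then have "agree Symbol x y"
        by (cases x; cases y) auto
      moreover have "\<exists>!z. z \<in> T \<and> agree Symbol x z \<and> col z mod 3 = m"
        using x m unfolding K_def by (intro col) simp_all
      ultimately show "x = y"
        using x y agree_refl[of Symbol x] unfolding K_def by blast
    qed
    moreover have "{k. \<exists>i j. (i, j, k) \<in> K m} = (\<lambda>x. snd (snd x)) ` K m"
      by force
    ultimately show "card {k. \<exists>i j. (i, j, k) \<in> K m} = card (K m)"
      by (simp add: card_image)
  qed
  ultimately show ?thesis
    by blast
qed

end
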